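(* Let $f,g:G\to H$ be homomorphisms of digraphs. If $f$ and $g$ are bihomotopic then $f$ is dihomotopic to $g$; and if $f$ is dihomotopic to $g$ then $f$ and $g$ are line-homotopic. Furthermore these implications are strict: there exist digraphs $G,H$ and homomorphisms $f,g:G\to H$ such that $f$ is dihomotopic to $g$ but $f$ and $g$ are not bihomotopic, and there exist digraphs $G,H$ and homomorphisms $f,h:G\to H$ such that $f$ and $h$ are line-homotopic but $f$ is not dihomotopic to $h$.
   Context: A digraph $G$ consists of a finite vertex set $V(G)$ and an edge set $E(G)\subseteq V(G)\times V(G)$ (loops are allowed, and $(v,w)$ and $(w,v)$ may both be edges). A multihomomorphism from $G$ to $H$ is a map $\alpha: V(G)\to 2^{V(H)}\setminus\{\emptyset\}$ such that $\alpha(v)\times\alpha(w)\subseteq E(H)$ for every $(v,w)\in E(G)$. $\overrightarrow{\mathrm{Hom}}(G,H)$ is the polyhedral subcomplex of $\prod_{x\in V(G)}\Delta^{V(H)}$ (where $\Delta^{S}$ is the simplex with vertex set $S$) whose cells are the products $\prod_{x}\Delta^{\alpha(x)}$ over all multihomomorphisms $\alpha$; its vertices are the homomorphisms $G\to H$. The exponential digraph $H^G$ has as vertices all set maps $V(G)\to V(H)$, with $(f,g)$ an edge iff $(f(v),g(v'))\in E(H)$ whenever $(v,v')\in E(G)$. For a digraph $T$, $T^{o}$ is the subgraph induced on the looped vertices; the vertices of $(H^G)^{o}$ are exactly the homomorphisms $G\to H$. For homomorphisms $f,g:G\to H$: they are bihomotopic if there is a (topological) path from $f$ to $g$ in $\overrightarrow{\mathrm{Hom}}(G,H)$;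 $f$ is dihomotopic to $g$ if there is a directed path from $f$ to $g$ in $(H^G)^{o}$; they are line-homotopic if there is a path from $f$ to $g$ in the underlying undirected graph of $(H^G)^{o}$. *)

theory Defs
  imports "HOL-Analysis.Analysis" "Graph_Theory.Graph_Theory"
begin

text \<open>
  A digraph is a \<^typ>\<open>'a pair_pre_digraph\<close> satisfying \<^locale>\<open>pair_fin_digraph\<close>: a finite vertex
  set and an arbitrary set of ordered pairs of vertices as arcs, loops allowed. Set maps out of
  \<^term>\<open>pverts G\<close> are extensional functions, so that two maps agreeing on the vertices are equal.
\<close>

definition digraph_homs :: "'a pair_pre_digraph \<Rightarrow> 'b pair_pre_digraph \<Rightarrow> ('a \<Rightarrow> 'b) set" where
  "digraph_homs G H =
     {f \<in> pverts G \<rightarrow>\<^sub>E pverts H. \<forall>(v, w) \<in> parcs G. (f v, f w) \<in> parcs H}"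

definition multihoms :: "'a pair_pre_digraph \<Rightarrow> 'b pair_pre_digraph \<Rightarrow> ('a \<Rightarrow> 'b set) set" where
  "multihoms G H =
     {\<alpha> \<in> pverts G \<rightarrow>\<^sub>E (Pow (pverts H) - {{}}). \<forall>(v, w) \<in> parcs G. \<alpha> v \<times> \<alpha> w \<subseteq> parcs H}"

text \<open>
  The geometric simplex with finite vertex set \<open>S\<close>, in barycentric coordinates, and its vertices.
\<close>

definition geom_simplex :: "'b set \<Rightarrow> ('b \<Rightarrow> real) set" where
  "geom_simplex S = {t. (\<forall>v. 0 \<le> t v) \<and> (\<forall>v. v \<notin> S \<longrightarrow> t v = 0) \<and> sum t S = 1}"

definition simplex_vertex :: "'b \<Rightarrow> 'b \<Rightarrow> real" where
  "simplex_vertex v = indicator {v}"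

text \<open>
  The cells lie in the product of one copy of \<^term>\<open>geom_simplex (pverts H)\<close> for each vertex of
  \<open>G\<close>. A point of it is a function of type \<^typ>\<open>'a \<Rightarrow> 'b \<Rightarrow> real\<close>, topologised by the library's
  product topology on function types. Coordinates outside \<^term>\<open>pverts G\<close> and \<^term>\<open>pverts H\<close> are
  constant, so for finite \<open>G\<close> and \<open>H\<close> this is the usual topology of the finite polyhedral complex.
\<close>

definition hom_cell :: "'a pair_pre_digraph \<Rightarrow> ('a \<Rightarrow> 'b set) \<Rightarrow> ('a \<Rightarrow> 'b \<Rightarrow> real) set" where
  "hom_cell G \<alpha> = (\<Pi>\<^sub>E x \<in> pverts G. geom_simplex (\<alpha> x))"

definition Hom_complex ::
    "'a pair_pre_digraph \<Rightarrow> 'b pair_pre_digraph \<Rightarrow> ('a \<Rightarrow> 'b \<Rightarrow> real) set" where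
  "Hom_complex G H = (\<Union>\<alpha> \<in> multihoms G H. hom_cell G \<alpha>)"

definition hom_point :: "'a pair_pre_digraph \<Rightarrow> ('a \<Rightarrow> 'b) \<Rightarrow> 'a \<Rightarrow> 'b \<Rightarrow> real" where
  "hom_point G f = (\<lambda>x \<in> pverts G. simplex_vertex (f x))"

definition exp_digraph ::
    "'a pair_pre_digraph \<Rightarrow> 'b pair_pre_digraph \<Rightarrow> ('a \<Rightarrow> 'b) pair_pre_digraph" where
  "exp_digraph G H =
     \<lparr> pverts = pverts G \<rightarrow>\<^sub>E pverts H,
       parcs = {(f, g). f \<in> pverts G \<rightarrow>\<^sub>E pverts H \<and> g \<in> pverts G \<rightarrow>\<^sub>E pverts H \<and>
                        (\<forall>(v, v') \<in> parcs G. (f v, g v') \<in> parcs H)} \<rparr>"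

definition looped_part :: "'a pair_pre_digraph \<Rightarrow> ('a, 'a \<times> 'a) pre_digraph" where
  "looped_part T = with_proj T \<restriction> {v \<in> pverts T. (v, v) \<in> parcs T}"

lemma verts_looped_part_exp_digraph:
  "verts (looped_part (exp_digraph G H)) = digraph_homs G H"
  by (auto simp: looped_part_def exp_digraph_def digraph_homs_def)

definition bihomotopic ::
    "'a pair_pre_digraph \<Rightarrow> 'b pair_pre_digraph \<Rightarrow> ('a \<Rightarrow> 'b) \<Rightarrow> ('a \<Rightarrow> 'b) \<Rightarrow> bool" where
  "bihomotopic G H f g \<longleftrightarrow> path_component (Hom_complex G H) (hom_point G f) (hom_point G g)"

text \<open>
  Paths in digraphs are finite sequences of consecutive arcs; vertices may repeat, and the empty
  sequence is a path from a vertex to itself.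
\<close>

definition dihomotopic ::
    "'a pair_pre_digraph \<Rightarrow> 'b pair_pre_digraph \<Rightarrow> ('a \<Rightarrow> 'b) \<Rightarrow> ('a \<Rightarrow> 'b) \<Rightarrow> bool" where
  "dihomotopic G H f g \<longleftrightarrow>
     (\<exists>p. pre_digraph.awalk (looped_part (exp_digraph G H)) f p g)"

text \<open>
  An undirected graph is represented by the digraph containing both orientations of each edge;
  \<^const>\<open>mk_symmetric\<close> thus yields the underlying undirected graph.
\<close>

definition line_homotopic ::
    "'a pair_pre_digraph \<Rightarrow> 'b pair_pre_digraph \<Rightarrow> ('a \<Rightarrow> 'b) \<Rightarrow> ('a \<Rightarrow> 'b) \<Rightarrow> bool" where
  "line_homotopic G H f g \<longleftrightarrow>
     (\<exists>p. pre_digraph.awalk (with_proj (mk_symmetric (looped_part (exp_digraph G H)))) f p g)"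

end

theory Submission
  imports Defs
begin

text \<open>
  Every point \<open>x\<close> of the complex carries a set of homomorphisms: the maps that pick, for
  each vertex \<open>v\<close> of \<open>G\<close>, a vertex of \<open>H\<close> with non-zero barycentric coordinate in \<open>x v\<close>. Since \<open>x\<close>
  lies in the cell of a multihomomorphism, any two of these homomorphisms are joined by arcs in both
  directions (\<open>selections_adjacent\<close>). A non-zero coordinate stays non-zero nearby, so a homomorphism
  selected at \<open>x\<close> is still selected at all points close to \<open>x\<close> (\<open>selections_locally_persist\<close>).
  Hence the property that \<open>f\<close> reaches a homomorphism selected at \<open>x\<close> by a directed path is locally
  constant in \<open>x\<close>, and therefore constant along any path in the complex. At the vertex of the complex
  given by a homomorphism, that homomorphism is the only one selected; this turns a topological path
  from \<open>f\<close> to \<open>g\<close> into a directed path, without any subdivision or cellular approximation.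

  For strictness, let \<open>G\<close> be a single looped vertex, so that homomorphisms out of \<open>G\<close> are the looped
  vertices of \<open>H\<close>, and let \<open>H\<close> consist of two looped vertices and one arc between them. There is a
  directed path along the arc but none back. Line-homotopy is symmetric, so the way back
  separates it from dihomotopy; bihomotopy is symmetric as well and implies dihomotopy in both
  directions, so the way along the arc is no bihomotopy.
\<close>

section \<open>Directed paths in the exponential digraph\<close>

lemma looped_exp_arc_iff:
  "f \<rightarrow>\<^bsub>looped_part (exp_digraph G H)\<^esub> g \<longleftrightarrow>
     f \<in> digraph_homs G H \<and> g \<in> digraph_homs G H \<and>
     (\<forall>(v, w) \<in> parcs G. (f v, g w) \<in> parcs H)"
  by (auto simp: looped_part_def exp_digraph_def digraph_homs_def arcs_ends_conv image_iff)

lemma wf_looped_exp: "wf_digraph (looped_part (exp_digraph G H))"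
proof -
  have "pair_wf_digraph (exp_digraph G H)"
    by unfold_locales (auto simp: exp_digraph_def)
  then interpret pair_wf_digraph "exp_digraph G H" .
  show ?thesis
    unfolding looped_part_def by (rule wellformed_induce_subgraph)
qed

lemma dihomotopic_iff_reachable:
  "dihomotopic G H f g \<longleftrightarrow> f \<rightarrow>\<^sup>*\<^bsub>looped_part (exp_digraph G H)\<^esub> g"
  unfolding dihomotopic_def by (simp add: wf_digraph.reachable_awalk[OF wf_looped_exp])

lemma line_homotopic_iff_reachable:
  "line_homotopic G H f g \<longleftrightarrow>
     f \<rightarrow>\<^sup>*\<^bsub>with_proj (mk_symmetric (looped_part (exp_digraph G H)))\<^esub> g"
proof -
  interpret pair_wf_digraph "mk_symmetric (looped_part (exp_digraph G H))"
    using wf_looped_exp by (rule wf_digraph.wellformed_mk_symmetric)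
  show ?thesis
    unfolding line_homotopic_def by (simp add: reachable_awalk)
qed

lemma dihomotopic_refl: "f \<in> digraph_homs G H \<Longrightarrow> dihomotopic G H f f"
  by (simp add: dihomotopic_iff_reachable verts_looped_part_exp_digraph reachable_def)

lemma dihomotopic_arc:
  assumes "dihomotopic G H f g" "g \<rightarrow>\<^bsub>looped_part (exp_digraph G H)\<^esub> h"
  shows "dihomotopic G H f h"
  using assms unfolding dihomotopic_iff_reachable
  by (rule wf_digraph.reachable_adj_trans[OF wf_looped_exp])

lemma dihomotopic_imp_line_homotopic:
  "dihomotopic G H f g \<Longrightarrow> line_homotopic G H f g"
  unfolding dihomotopic_iff_reachable line_homotopic_iff_reachable
  by (rule wf_digraph.reachable_mk_symmetricI[OF wf_looped_exp])

lemma line_homotopic_sym: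
  "line_homotopic G H f g \<Longrightarrow> line_homotopic G H g f"
  unfolding line_homotopic_iff_reachable
  by (rule symmetric_reachable[OF symmetric_mk_symmetric])

section \<open>Homomorphisms selected by a point of the complex\<close>

definition selections :: "'a pair_pre_digraph \<Rightarrow> ('a \<Rightarrow> 'b \<Rightarrow> real) \<Rightarrow> ('a \<Rightarrow> 'b) set" where
  "selections G x = (\<Pi>\<^sub>E v \<in> pverts G. {w. x v w \<noteq> 0})"

text \<open>Barycentric coordinates sum to 1, so they cannot all vanish.\<close>
lemma selections_nonempty:
  assumes "x \<in> Hom_complex G H"
  shows "selections G x \<noteq> {}"
proof -
  obtain \<alpha> where x: "x \<in> hom_cell G \<alpha>"
    using assms by (auto simp: Hom_complex_def)
  have "{w. x v w \<noteq> 0} \<noteq> {}" if "v \<in> pverts G" for v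
  proof
    assume "{w. x v w \<noteq> 0} = {}"
    then have "sum (x v) (\<alpha> v) = 0"
      by (auto intro: sum.neutral)
    moreover have "x v \<in> geom_simplex (\<alpha> v)"
      using x that unfolding hom_cell_def by (rule PiE_mem)
    ultimately show False
      by (simp add: geom_simplex_def)
  qed
  then show ?thesis
    by (simp add: selections_def PiE_eq_empty_iff)
qed

text \<open>
  Selections at \<open>x\<close> take their values in a multihomomorphism \<open>\<alpha>\<close> whose cell contains \<open>x\<close>, and
  \<^prop>\<open>\<alpha> v \<times> \<alpha> w \<subseteq> parcs H\<close> allows a different selection at each end of an arc.
\<close>
lemma selections_adjacent:
  assumes "x \<in> Hom_complex G H" "h \<in> selections G x" "k \<in> selections G x"
    and G: "pair_wf_digraph G"
  shows "h \<rightarrow>\<^bsub>looped_part (exp_digraph G H)\<^esub> k"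
proof -
  interpret pair_wf_digraph G by (rule G)
  obtain \<alpha> where \<alpha>: "\<alpha> \<in> multihoms G H" and x: "x \<in> hom_cell G \<alpha>"
    using assms(1) by (auto simp: Hom_complex_def)
  have in_cell: "s v \<in> \<alpha> v" if "s \<in> selections G x" "v \<in> pverts G" for s v
  proof -
    have "x v \<in> geom_simplex (\<alpha> v)"
      using x that(2) unfolding hom_cell_def by (rule PiE_mem)
    moreover have "x v (s v) \<noteq> 0"
      using that by (auto simp: selections_def)
    ultimately show ?thesis
      by (auto simp: geom_simplex_def)
  qed
  have arc: "(s v, t w) \<in> parcs H"
    if "s \<in> selections G x" "t \<in> selections G x" "(v, w) \<in> parcs G" for s t v w
  proof -
    have "s v \<in> \<alpha> v" "t w \<in> \<alpha> w"
      using that in_cell arc_fst_in_verts arc_snd_in_verts by fastforce+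
    moreover have "\<alpha> v \<times> \<alpha> w \<subseteq> parcs H"
      using \<alpha> that(3) by (auto simp: multihoms_def)
    ultimately show ?thesis by auto
  qed
  have "s \<in> digraph_homs G H" if s: "s \<in> selections G x" for s
  proof -
    have "s v \<in> pverts H" if "v \<in> pverts G" for v
      using in_cell[OF s that] \<alpha> that by (auto simp: multihoms_def dest!: PiE_mem)
    moreover have "s \<in> extensional (pverts G)"
      using s by (simp add: selections_def PiE_def)
    ultimately show ?thesis
      using arc[OF s s] by (auto simp: digraph_homs_def PiE_def)
  qed
  then show ?thesis
    using assms(2,3) arc by (auto simp: looped_exp_arc_iff)
qed

text \<open>Being selected is an open condition, given by finitely many non-vanishing coordinates.\<close>
lemma selections_locally_persist:
  fixes x :: "'a \<Rightarrow> 'b \<Rightarrow> real"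
  assumes "finite (pverts G)" "h \<in> selections G x"
  shows "\<forall>\<^sub>F y in at x within S. h \<in> selections G y"
proof -
  have "\<forall>\<^sub>F y in at x within S. y v (h v) \<noteq> 0" if "v \<in> pverts G" for v
  proof (rule tendsto_imp_eventually_ne)
    have "continuous_on UNIV (\<lambda>y::'a \<Rightarrow> 'b \<Rightarrow> real. y v (h v))"
      by (rule continuous_on_product_then_coordinatewise[OF continuous_on_product_coordinates])
    then show "((\<lambda>y. y v (h v)) \<longlongrightarrow> x v (h v)) (at x within S)"
      unfolding continuous_on_def by (blast intro: tendsto_within_subset)
    show "x v (h v) \<noteq> 0"
      using assms(2) that by (auto simp: selections_def)
  qed
  then have "\<forall>\<^sub>F y in at x within S. \<forall>v \<in> pverts G. y v (h v) \<noteq> 0"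
    using assms(1) by (simp add: eventually_ball_finite)
  then show ?thesis
    by (rule eventually_mono)
      (use assms(2) in \<open>auto simp: selections_def PiE_def\<close>)
qed

lemma selections_hom_point:
  assumes "f \<in> extensional (pverts G)"
  shows "selections G (hom_point G f) = {f}"
proof -
  have "{w. hom_point G f v w \<noteq> 0} = {f v}" if "v \<in> pverts G" for v
    using that by (auto simp: hom_point_def simplex_vertex_def indicator_def)
  then have "selections G (hom_point G f) = (\<Pi>\<^sub>E v \<in> pverts G. {f v})"
    unfolding selections_def by (rule PiE_cong)
  also have "\<dots> = {f}"
    using assms by (rule PiE_singleton)
  finally show ?thesis .
qed

section \<open>Comparison of the homotopy relations\<close>

lemma bihomotopic_sym: "bihomotopic G H f g \<Longrightarrow> bihomotopic G H g f"
  unfolding bihomotopic_def by (rule path_component_sym)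

lemma bihomotopic_imp_dihomotopic:
  assumes G: "pair_fin_digraph G"
    and f: "f \<in> digraph_homs G H" and g: "g \<in> digraph_homs G H"
    and fg: "bihomotopic G H f g"
  shows "dihomotopic G H f g"
proof -
  interpret pair_fin_digraph G by (rule G)
  have ext: "f \<in> extensional (pverts G)" "g \<in> extensional (pverts G)"
    using f g by (auto simp: digraph_homs_def PiE_def)
  define R where "R x \<longleftrightarrow> (\<exists>h \<in> selections G x. dihomotopic G H f h)" for x
  \<comment> \<open>Selections at one point are mutually adjacent, so any single one of them decides \<open>R\<close>.\<close>
  have R_iff: "R x \<longleftrightarrow> dihomotopic G H f h"
    if "x \<in> Hom_complex G H" "h \<in> selections G x" for x h
    using that dihomotopic_arc selections_adjacent[OF that(1) _ that(2)
        pair_fin_digraph.axioms(1)[OF G]]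
    unfolding R_def by blast
  obtain C where C: "Topological_Spaces.connected C" "C \<subseteq> Hom_complex G H"
      "hom_point G f \<in> C" "hom_point G g \<in> C"
    using fg connected_path_image pathstart_in_path_image pathfinish_in_path_image
    unfolding bihomotopic_def path_component_def by metis
  have "\<forall>\<^sub>F y in at x within C. R x = R y" if x: "x \<in> C" for x
  proof -
    obtain h where h: "h \<in> selections G x"
      using selections_nonempty C(2) x by blast
    have "\<forall>\<^sub>F y in at x within C. h \<in> selections G y"
      using pair_finite_verts h by (rule selections_locally_persist)
    moreover have "\<forall>\<^sub>F y in at x within C. y \<in> C"
      by (simp add: eventually_at_filter)
    ultimately show ?thesis
      by eventually_elim (use R_iff h x C(2) in blast)
  qed
  then have "R (hom_point G f) = R (hom_point G g)"
    using C by (intro connected_local_const[of C]) auto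
  then show ?thesis
    by (simp add: R_def selections_hom_point ext dihomotopic_refl[OF f])
qed

section \<open>An arc that cannot be traversed backwards\<close>

definition looped_point :: "nat pair_pre_digraph" where
  "looped_point = \<lparr> pverts = {0}, parcs = {(0, 0)} \<rparr>"

definition looped_arc :: "nat pair_pre_digraph" where
  "looped_arc = \<lparr> pverts = {0, 1}, parcs = {(0, 0), (0, 1), (1, 1)} \<rparr>"

definition point_at :: "nat \<Rightarrow> nat \<Rightarrow> nat" where
  "point_at i = (\<lambda>_ \<in> {0}. i)"

lemma fin_digraph_looped_point: "pair_fin_digraph looped_point"
  by unfold_locales (auto simp: looped_point_def)

lemma fin_digraph_looped_arc: "pair_fin_digraph looped_arc"
  by unfold_locales (auto simp: looped_arc_def)

lemma point_at_hom: "i \<in> {0, 1} \<Longrightarrow> point_at i \<in> digraph_homs looped_point looped_arc"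
  by (auto simp: digraph_homs_def looped_point_def looped_arc_def point_at_def)

lemma dihomotopic_along_arc: "dihomotopic looped_point looped_arc (point_at 0) (point_at 1)"
proof (rule dihomotopic_arc)
  show "dihomotopic looped_point looped_arc (point_at 0) (point_at 0)"
    by (simp add: dihomotopic_refl point_at_hom)
  show "point_at 0 \<rightarrow>\<^bsub>looped_part (exp_digraph looped_point looped_arc)\<^esub> point_at 1"
    by (simp add: looped_exp_arc_iff point_at_hom)
      (simp add: looped_point_def looped_arc_def point_at_def)
qed

text \<open>The only arc out of vertex 1 is its loop, so a walk starting there never leaves it.\<close>
lemma not_dihomotopic_against_arc:
  "\<not> dihomotopic looped_point looped_arc (point_at 1) (point_at 0)"
proof -
  have "h 0 = 1" if "dihomotopic looped_point looped_arc (point_at 1) h" for h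
    using that unfolding dihomotopic_iff_reachable
  proof (induction rule: wf_digraph.reachable_induct[OF wf_looped_exp, consumes 1])
    case 1
    show ?case by (simp add: point_at_def)
  next
    case (2 h k)
    then show ?case
      by (auto simp: looped_exp_arc_iff looped_point_def looped_arc_def)
  qed
  from this[of "point_at 0"] show ?thesis
    by (auto simp: point_at_def)
qed

lemma not_bihomotopic_along_arc:
  "\<not> bihomotopic looped_point looped_arc (point_at 0) (point_at 1)"
proof
  assume "bihomotopic looped_point looped_arc (point_at 0) (point_at 1)"
  then have "bihomotopic looped_point looped_arc (point_at 1) (point_at 0)"
    by (rule bihomotopic_sym)
  then have "dihomotopic looped_point looped_arc (point_at 1) (point_at 0)"
    by (intro bihomotopic_imp_dihomotopic fin_digraph_looped_point point_at_hom) simp_all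
  then show False
    using not_dihomotopic_against_arc by contradiction
qed

theorem proposition6p9:
  shows "(\<forall>(G :: 'a pair_pre_digraph) (H :: 'b pair_pre_digraph) f g.
            pair_fin_digraph G \<longrightarrow> pair_fin_digraph H \<longrightarrow>
            f \<in> digraph_homs G H \<longrightarrow> g \<in> digraph_homs G H \<longrightarrow>
              (bihomotopic G H f g \<longrightarrow> dihomotopic G H f g) \<and>
              (dihomotopic G H f g \<longrightarrow> line_homotopic G H f g)) \<and>
         (\<exists>(G :: nat pair_pre_digraph) (H :: nat pair_pre_digraph) f g.
            pair_fin_digraph G \<and> pair_fin_digraph H \<and>
            f \<in> digraph_homs G H \<and> g \<in> digraph_homs G H \<and>
            dihomotopic G H f g \<and> \<not> bihomotopic G H f g) \<and>
         (\<exists>(G :: nat pair_pre_digraph) (H :: nat pair_pre_digraph) f h.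
            pair_fin_digraph G \<and> pair_fin_digraph H \<and>
            f \<in> digraph_homs G H \<and> h \<in> digraph_homs G H \<and>
            line_homotopic G H f h \<and> \<not> dihomotopic G H f h)"
proof (intro conjI allI impI)
  fix G :: "'a pair_pre_digraph" and H :: "'b pair_pre_digraph" and f g
  assume "pair_fin_digraph G" "f \<in> digraph_homs G H" "g \<in> digraph_homs G H" "bihomotopic G H f g"
  then show "dihomotopic G H f g"
    by (rule bihomotopic_imp_dihomotopic)
next
  fix G :: "'a pair_pre_digraph" and H :: "'b pair_pre_digraph" and f g
  assume "dihomotopic G H f g"
  then show "line_homotopic G H f g"
    by (rule dihomotopic_imp_line_homotopic)
next
  show "\<exists>(G :: nat pair_pre_digraph) (H :: nat pair_pre_digraph) f g.
            pair_fin_digraph G \<and> pair_fin_digraph H \<and>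
            f \<in> digraph_homs G H \<and> g \<in> digraph_homs G H \<and>
            dihomotopic G H f g \<and> \<not> bihomotopic G H f g"
    using fin_digraph_looped_point fin_digraph_looped_arc point_at_hom[of 0] point_at_hom[of 1]
      dihomotopic_along_arc not_bihomotopic_along_arc
    by blast
next
  have "line_homotopic looped_point looped_arc (point_at 1) (point_at 0)"
    using line_homotopic_sym[OF dihomotopic_imp_line_homotopic[OF dihomotopic_along_arc]] .
  then show "\<exists>(G :: nat pair_pre_digraph) (H :: nat pair_pre_digraph) f h.
            pair_fin_digraph G \<and> pair_fin_digraph H \<and>
            f \<in> digraph_homs G H \<and> h \<in> digraph_homs G H \<and>
            line_homotopic G H f h \<and> \<not> dihomotopic G H f h"
    using fin_digraph_looped_point fin_digraph_looped_arc point_at_hom[of 0] point_at_hom[of 1]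
      not_dihomotopic_against_arc
    by blast
qed

end
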